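(* The space $\mathbb{R}^{\omega}=\prod_{i\in\mathbb{N}}\mathbb{R}$ equipped with the product topology, metrized by $${\bf d}(x,y):=\sup_{i\ge1}\frac{\min\{|x_i-y_i|,1\}}{i},\qquad x=(x_i)_{i\in\mathbb{N}},\ y=(y_i)_{i\in\mathbb{N}}\in\mathbb{R}^\omega,$$ has the Lebesgue property; that is, every Riemann integrable function $f:[a,b]\to(\mathbb{R}^{\omega},{\bf d})$ is continuous almost everywhere on $[a,b]$.
   Context: $\mathbb{N}=\{1,2,\dots\}$. The metric ${\bf d}$ in the claim is complete, invariant (${\bf d}(x+z,y+z)={\bf d}(x,y)$), and induces the product topology on $\mathbb{R}^\omega$. Let $X$ be a real vector space with a complete and invariant metric ${\bf d}$. A tagged partition of $[a,b]$ is $\Delta=\{(s_i,[t_{i-1},t_i]):1\le i\le N\}$ with $a=t_0<t_1<\dots<t_N=b$ and $s_i\in[t_{i-1},t_i]$; write $|\Delta|:=\max_{1\le i\le N}(t_i-t_{i-1})$ and $f(\Delta):=\sum_{i=1}^N(t_i-t_{i-1})f(s_i)$. A function $f:[a,b]\to X$ is Riemann integrable on $[a,b]$ if there is $\bar x\in X$ such that for every $\varepsilon>0$ there is $\delta>0$ with ${\bf d}(f(\Delta),\bar x)<\varepsilon$ for every tagged partition $\Delta$ of $[a,b]$ with $|\Delta|<\delta$. $X$ has the Lebesgue property if every Riemann integrable function $f:[a,b]\to X$ is continuous at Lebesgue-almost every point of $[a,b]$. *)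

theory Defs
  imports "HOL-Analysis.Analysis" "HOL-Library.Function_Algebras"
begin

instantiation "fun" :: (type, real_vector) real_vector
begin

definition scaleR_fun :: "real \<Rightarrow> ('a \<Rightarrow> 'b) \<Rightarrow> 'a \<Rightarrow> 'b" where
  "scaleR_fun c f = (\<lambda>i. c *\<^sub>R f i)"

instance
  by standard (simp_all add: scaleR_fun_def fun_eq_iff scaleR_add_right scaleR_add_left)

end

(* N intervals with endpoints t 0, ..., t N and tags s 1, ..., s N; the values of
   t beyond N and of s outside {1..N} are irrelevant. *)
definition tagged_partition ::
    "real \<Rightarrow> real \<Rightarrow> nat \<Rightarrow> (nat \<Rightarrow> real) \<Rightarrow> (nat \<Rightarrow> real) \<Rightarrow> bool" where
  "tagged_partition a b N t s \<longleftrightarrow>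
     1 \<le> N \<and> t 0 = a \<and> t N = b \<and>
     (\<forall>i\<in>{1..N}. t (i - 1) < t i \<and> s i \<in> {t (i - 1)..t i})"

definition mesh :: "nat \<Rightarrow> (nat \<Rightarrow> real) \<Rightarrow> real" where
  "mesh N t = Max ((\<lambda>i. t i - t (i - 1)) ` {1..N})"

definition riemann_sum ::
    "(real \<Rightarrow> 'a::real_vector) \<Rightarrow> nat \<Rightarrow> (nat \<Rightarrow> real) \<Rightarrow> (nat \<Rightarrow> real) \<Rightarrow> 'a" where
  "riemann_sum f N t s = (\<Sum>i=1..N. (t i - t (i - 1)) *\<^sub>R f (s i))"

locale complete_invariant_metric = Metric_space UNIV d
  for d :: "'a::real_vector \<Rightarrow> 'a \<Rightarrow> real" +
  assumes complete: "mcomplete"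
    and invariant: "d (x + z) (y + z) = d x y"
begin

definition riemann_integrable_on :: "(real \<Rightarrow> 'a) \<Rightarrow> real \<Rightarrow> real \<Rightarrow> bool" where
  "riemann_integrable_on f a b \<longleftrightarrow>
     (\<exists>l. \<forall>\<epsilon>>0. \<exists>\<delta>>0. \<forall>N t s.
        tagged_partition a b N t s \<and> mesh N t < \<delta> \<longrightarrow> d (riemann_sum f N t s) l < \<epsilon>)"

(* A function on [a,b] is a total function whose values outside [a,b] play no role;
   in particular continuity is relative to the subspace [a,b]. *)
definition lebesgue_property :: bool where
  "lebesgue_property \<longleftrightarrow>
     (\<forall>a b f. a < b \<and> riemann_integrable_on f a b \<longrightarrow>
        (AE x in lebesgue_on {a..b}. topcontinuous_at (top_of_set {a..b}) mtopology f x))"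

end

(* Coordinates are indexed from 0: the coordinate x_i, i = 1, 2, ..., is x (i - 1). *)
type_synonym romega = "nat \<Rightarrow> real"

definition romega_dist :: "romega \<Rightarrow> romega \<Rightarrow> real" where
  "romega_dist x y = (SUP i\<in>{1..}. min \<bar>x (i - 1) - y (i - 1)\<bar> 1 / real i)"

lemma romega_dist_bdd:
  "bdd_above ((\<lambda>i. min \<bar>x (i - 1) - y (i - 1)\<bar> 1 / real i) ` {1..})" for x y :: romega
proof (rule bdd_aboveI2[where M = 1])
  fix i :: nat assume "i \<in> {1..}"
  then have "1 \<le> real i" by simp
  then show "min \<bar>x (i - 1) - y (i - 1)\<bar> 1 / real i \<le> 1"
    by (simp add: divide_le_eq)
qed

lemma romega_dist_coord_le: "min \<bar>x n - y n\<bar> 1 / real (Suc n) \<le> romega_dist x y"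
  using cSUP_upper[OF _ romega_dist_bdd, of "Suc n" x y] by (simp add: romega_dist_def)

lemma romega_dist_leI:
  assumes "\<And>n. min \<bar>x n - y n\<bar> 1 / real (Suc n) \<le> e"
  shows "romega_dist x y \<le> e"
  unfolding romega_dist_def
proof (rule cSUP_least)
  fix i :: nat assume "i \<in> {1..}"
  then show "min \<bar>x (i - 1) - y (i - 1)\<bar> 1 / real i \<le> e"
    using assms[of "i - 1"] by simp
qed simp

lemma romega_dist_coord_less:
  assumes "romega_dist x y < min e 1 / real (Suc n)"
  shows "\<bar>x n - y n\<bar> < e"
proof -
  have "min \<bar>x n - y n\<bar> 1 / real (Suc n) < min e 1 / real (Suc n)"
    using romega_dist_coord_le assms by (rule le_less_trans)
  then have "min \<bar>x n - y n\<bar> 1 < min e 1"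
    by (simp add: divide_less_cancel del: of_nat_Suc)
  then show ?thesis by linarith
qed

lemma Metric_space_romega: "Metric_space UNIV romega_dist"
proof
  show nonneg: "0 \<le> romega_dist x y" for x y
  proof -
    have "0 \<le> min \<bar>x 0 - y 0\<bar> 1 / real (Suc 0)" by simp
    then show ?thesis using romega_dist_coord_le[of x 0 y] by linarith
  qed
  show "romega_dist x y = romega_dist y x" for x y
    by (simp add: romega_dist_def abs_minus_commute)
  show "(romega_dist x y = 0) = (x = y)" for x y
  proof
    assume eq: "romega_dist x y = 0"
    have "x n = y n" for n
    proof (rule ccontr)
      assume "x n \<noteq> y n"
      then have "romega_dist x y < min \<bar>x n - y n\<bar> 1 / real (Suc n)"
        unfolding eq by (simp del: of_nat_Suc)
      then show False using romega_dist_coord_le[of x n y] by linarith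
    qed
    then show "x = y" by (rule ext)
  next
    assume "x = y"
    then show "romega_dist x y = 0"
      using nonneg[of x y] romega_dist_leI[of x y 0] by simp
  qed
  show "romega_dist x z \<le> romega_dist x y + romega_dist y z" for x y z
  proof (rule romega_dist_leI)
    fix n
    have "min \<bar>x n - z n\<bar> 1 \<le> min \<bar>x n - y n\<bar> 1 + min \<bar>y n - z n\<bar> 1"
      by linarith
    then have "min \<bar>x n - z n\<bar> 1 / real (Suc n)
        \<le> min \<bar>x n - y n\<bar> 1 / real (Suc n) + min \<bar>y n - z n\<bar> 1 / real (Suc n)"
      unfolding add_divide_distrib[symmetric] by (intro divide_right_mono) auto
    then show "min \<bar>x n - z n\<bar> 1 / real (Suc n) \<le> romega_dist x y + romega_dist y z"
      using romega_dist_coord_le[of x n y] romega_dist_coord_le[of y n z] by linarith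
  qed
qed

lemma romega_mtopology:
  "Metric_space.mtopology UNIV romega_dist = product_topology (\<lambda>_. euclideanreal) UNIV"
proof -
  interpret Metric_space UNIV romega_dist by (rule Metric_space_romega)
  have coord: "continuous_map mtopology euclideanreal (\<lambda>x. x n)" for n
    unfolding continuous_map_def
  proof (intro conjI allI impI)
    fix V :: "real set" assume "openin euclideanreal V"
    then have V: "open V" by simp
    show "openin mtopology {x \<in> topspace mtopology. x n \<in> V}"
      unfolding openin_mtopology
    proof (intro conjI allI impI)
      fix x :: romega assume "x \<in> {x \<in> topspace mtopology. x n \<in> V}"
      then have "x n \<in> V" by simp
      then obtain e where e: "0 < e" "ball (x n) e \<subseteq> V"
        using V open_contains_ball by blast
      show "\<exists>r>0. mball x r \<subseteq> {x \<in> topspace mtopology. x n \<in> V}"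
      proof (intro exI[of _ "min e 1 / real (Suc n)"] conjI subsetI)
        show "0 < min e 1 / real (Suc n)" using e(1) by (simp del: of_nat_Suc)
        fix y assume "y \<in> mball x (min e 1 / real (Suc n))"
        then have "\<bar>x n - y n\<bar> < e" by (auto intro: romega_dist_coord_less)
        then show "y \<in> {x \<in> topspace mtopology. x n \<in> V}"
          using e(2) by (auto simp: dist_real_def)
      qed
    qed simp
  qed simp
  have cont: "continuous_map mtopology (product_topology (\<lambda>_. euclideanreal) UNIV) (\<lambda>x. x)"
    unfolding continuous_map_componentwise_UNIV using coord by blast
  have 1: "openin mtopology U"
    if "openin (product_topology (\<lambda>_. euclideanreal) UNIV) U" for U
    using openin_continuous_map_preimage[OF cont that] by simp
  have 2: "open U" if U: "openin mtopology U" for U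
  proof (subst open_subopen, intro ballI)
    fix x assume "x \<in> U"
    then obtain r where r: "0 < r" "mball x r \<subseteq> U"
      using U openin_mtopology by blast
    obtain M :: nat where M: "2 / r < real M" using reals_Archimedean2 by blast
    define V where "V = (\<Inter>n\<in>{..M}. {y :: romega. \<bar>x n - y n\<bar> < r / 2})"
    have "open V" unfolding V_def
      by (intro open_INT open_Collect_less ballI continuous_intros
            continuous_on_product_coordinates) auto
    moreover have "x \<in> V" using r(1) by (simp add: V_def)
    moreover have "V \<subseteq> U"
    proof
      fix y assume y: "y \<in> V"
      have "romega_dist x y \<le> r / 2"
      proof (rule romega_dist_leI)
        fix n
        show "min \<bar>x n - y n\<bar> 1 / real (Suc n) \<le> r / 2"
        proof (cases "n \<le> M")
          case True
          then have "\<bar>x n - y n\<bar> < r / 2" using y by (simp add: V_def)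
          then have "min \<bar>x n - y n\<bar> 1 \<le> r / 2" by linarith
          moreover have "r / 2 \<le> r / 2 * real (Suc n)"
            using r(1) by (simp add: algebra_simps)
          ultimately show ?thesis by (simp add: pos_divide_le_eq del: of_nat_Suc)
        next
          case False
          then have "2 / r < real (Suc n)" using M by linarith
          then have "1 \<le> r / 2 * real (Suc n)" using r(1) by (simp add: field_simps)
          then have "min \<bar>x n - y n\<bar> 1 \<le> r / 2 * real (Suc n)" by linarith
          then show ?thesis by (simp add: pos_divide_le_eq del: of_nat_Suc)
        qed
      qed
      then have "y \<in> mball x r" using r(1) by simp
      then show "y \<in> U" using r(2) by blast
    qed
    ultimately show "\<exists>T. open T \<and> x \<in> T \<and> T \<subseteq> U" by blast
  qed
  show ?thesis
    unfolding topology_eq using 1 2 by (auto simp: open_fun_def)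
qed

interpretation romega: complete_invariant_metric romega_dist
proof -
  interpret Metric_space UNIV romega_dist by (rule Metric_space_romega)
  show "complete_invariant_metric romega_dist"
  proof
    show "romega_dist (x + z) (y + z) = romega_dist x y" for x y z
      by (simp add: romega_dist_def)
    show mcomplete
      unfolding mcomplete_def
    proof (intro allI impI)
      fix \<sigma> assume \<sigma>: "MCauchy \<sigma>"
      have "Cauchy (\<lambda>k. \<sigma> k n)" for n
      proof (rule metric_CauchyI)
        fix e :: real assume "0 < e"
        then have "0 < min e 1 / real (Suc n)" by (simp del: of_nat_Suc)
        then obtain K where
          "\<And>j k. K \<le> j \<Longrightarrow> K \<le> k \<Longrightarrow> romega_dist (\<sigma> j) (\<sigma> k) < min e 1 / real (Suc n)"
          using \<sigma> unfolding MCauchy_def by metis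
        then show "\<exists>K. \<forall>j\<ge>K. \<forall>k\<ge>K. dist (\<sigma> j n) (\<sigma> k n) < e"
          unfolding dist_real_def using romega_dist_coord_less by metis
      qed
      then have "\<exists>l. (\<lambda>k. \<sigma> k n) \<longlonglongrightarrow> l" for n
        using Cauchy_convergent convergent_def by blast
      then obtain x where "\<And>n. (\<lambda>k. \<sigma> k n) \<longlonglongrightarrow> x n" by metis
      then show "\<exists>x. limitin mtopology \<sigma> x sequentially"
        unfolding romega_mtopology limitin_componentwise by (intro exI[of _ x]) auto
    qed
  qed
qed

end

theory Submission
  imports Defs
begin

text \<open>The topology of \<open>\<real>\<^sup>\<omega>\<close> is that of pointwise convergence, so each coordinate of an integrable
function is integrable, and by the classical Lebesgue criterion it is continuous off a null set;
the countable union of these null sets is null.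
For the criterion, fix \<open>\<eta>\<close> and two taggings of one fine partition whose values differ by at least
\<open>\<eta>\<close> on each interval where this is possible. Their Riemann sums are close, so these intervals have
small total length, and up to the finitely many end points they cover the set where the
oscillation is at least \<open>\<eta>\<close>.\<close>

text \<open>The comparison is with the value at \<open>x\<close> itself, not between two nearby
  points. Hence lying outside these sets for arbitrarily small \<open>\<eta>\<close> is the
  epsilon-delta form of continuity at \<open>x\<close> relative to \<open>S\<close>.\<close>

definition oscillation_ge_set :: "(real \<Rightarrow> real) \<Rightarrow> real set \<Rightarrow> real \<Rightarrow> real set" where
  "oscillation_ge_set g S \<eta> = {x \<in> S. \<forall>r>0. \<exists>y\<in>S. \<bar>y - x\<bar> < r \<and> \<eta> \<le> \<bar>g y - g x\<bar>}"

lemma uniform_tagged_partition: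
  assumes "a < b" "1 \<le> N" and t_def: "t = (\<lambda>i. a + real i * ((b - a) / real N))"
  shows "tagged_partition a b N t s \<longleftrightarrow> (\<forall>i\<in>{1..N}. s i \<in> {t (i - 1)..t i})"
    and "mesh N t = (b - a) / real N"
proof -
  have h: "0 < (b - a) / real N" using assms by simp
  have step: "t i - t (i - 1) = (b - a) / real N" if "i \<in> {1..N}" for i
    using that by (simp add: t_def of_nat_diff algebra_simps diff_divide_distrib)
  then have "t (i - 1) < t i" if "i \<in> {1..N}" for i
    using h that by fastforce
  then show "tagged_partition a b N t s \<longleftrightarrow> (\<forall>i\<in>{1..N}. s i \<in> {t (i - 1)..t i})"
    unfolding tagged_partition_def using assms(2) by (auto simp: t_def)
  have "(\<lambda>i. t i - t (i - 1)) ` {1..N} = {(b - a) / real N}"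
    using step assms(2) by (force simp: image_iff)
  then show "mesh N t = (b - a) / real N" by (simp add: mesh_def)
qed

text \<open>The strict inequalities leave room for a neighbourhood of \<open>x\<close> inside one
  interval; the exceptional points are finitely many, hence negligible.\<close>

lemma partition_cover:
  fixes t :: "nat \<Rightarrow> real"
  assumes "x \<in> {t 0..t N}"
  shows "x \<in> t ` {0..N} \<or> (\<exists>i\<in>{1..N}. t (i - 1) < x \<and> x < t i)"
  using assms
proof (induction N)
  case 0
  then show ?case by simp
next
  case (Suc N)
  show ?case
  proof (cases "x \<le> t N")
    case True
    with Suc have "x \<in> t ` {0..N} \<or> (\<exists>i\<in>{1..N}. t (i - 1) < x \<and> x < t i)" by simp
    then show ?thesis by fastforce
  next
    case False
    with Suc.prems have "x = t (Suc N) \<or> (t (Suc N - 1) < x \<and> x < t (Suc N))" by auto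
    then show ?thesis by fastforce
  qed
qed

lemma negligible_oscillation_ge_set:
  fixes g :: "real \<Rightarrow> real"
  assumes "a < b" "0 < \<eta>"
    and int: "\<And>\<epsilon>. 0 < \<epsilon> \<Longrightarrow> \<exists>\<delta>>0. \<forall>N t s.
      tagged_partition a b N t s \<and> mesh N t < \<delta> \<longrightarrow> \<bar>riemann_sum g N t s - l\<bar> < \<epsilon>"
  shows "negligible (oscillation_ge_set g {a..b} \<eta>)"
  unfolding negligible_outer_le
proof (intro allI impI)
  fix e :: real assume "0 < e"
  \<comment> \<open>Two sums this close to \<open>l\<close> differ by less than
    \<open>e * \<eta>\<close>; dividing by the gap \<open>\<eta>\<close> will leave a total length
    below \<open>e\<close>.\<close>
  then have "0 < e * \<eta> / 2" using assms by simp
  from int[OF this] obtain \<delta> where "0 < \<delta>" and \<delta>: "\<And>N t s.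
      tagged_partition a b N t s \<Longrightarrow> mesh N t < \<delta> \<Longrightarrow> \<bar>riemann_sum g N t s - l\<bar> < e * \<eta> / 2"
    by blast
  obtain N :: nat where N: "(b - a) / \<delta> < real N" using reals_Archimedean2 by blast
  have "0 < (b - a) / \<delta>" using \<open>0 < \<delta>\<close> \<open>a < b\<close> by simp
  then have N1: "1 \<le> N" using N by linarith
  define t where "t = (\<lambda>i. a + real i * ((b - a) / real N))"
  note unif = uniform_tagged_partition[OF \<open>a < b\<close> N1 t_def]
  have "(b - a) / real N < \<delta>"
    using N N1 \<open>0 < \<delta>\<close> by (simp add: field_simps)
  then have mesh: "mesh N t < \<delta>" by (simp add: unif)
  have t0N: "t 0 = a" "t N = b" using N1 by (auto simp: t_def)
  have tle: "t (i - 1) \<le> t i" for i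
    unfolding t_def using \<open>a < b\<close> N1 by (intro add_left_mono mult_right_mono) auto
  define J where "J i = {t (i - 1)..t i}" for i
  \<comment> \<open>The signed difference loses nothing, as \<open>u\<close> and \<open>v\<close>
    may be swapped, and it prevents cancellation between the intervals of \<open>B\<close> when the
    two sums are subtracted.\<close>
  define B where "B = {i\<in>{1..N}. \<exists>u\<in>J i. \<exists>v\<in>J i. \<eta> \<le> g u - g v}"
  have "\<exists>u v. i \<in> B \<longrightarrow> u \<in> J i \<and> v \<in> J i \<and> \<eta> \<le> g u - g v" for i
    unfolding B_def by blast
  then obtain u v where uv: "\<And>i. i \<in> B \<Longrightarrow> u i \<in> J i \<and> v i \<in> J i \<and> \<eta> \<le> g (u i) - g (v i)"
    by metis
  \<comment> \<open>Off \<open>B\<close> both taggings use the right end point, so these intervals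
    drop out of the difference of the sums.\<close>
  define u' where "u' i = (if i \<in> B then u i else t i)" for i
  define v' where "v' i = (if i \<in> B then v i else t i)" for i
  have B: "finite B" "B \<subseteq> {1..N}" by (auto simp: B_def)
  have tp: "tagged_partition a b N t u'" "tagged_partition a b N t v'"
    unfolding unif u'_def v'_def using uv tle by (auto simp: J_def)
  have "riemann_sum g N t u' - riemann_sum g N t v' =
      (\<Sum>i=1..N. (t i - t (i - 1)) * (g (u' i) - g (v' i)))"
    by (simp add: riemann_sum_def sum_subtractf[symmetric] right_diff_distrib)
  also have "\<dots> = (\<Sum>i\<in>B. (t i - t (i - 1)) * (g (u' i) - g (v' i)))"
    using B by (intro sum.mono_neutral_right) (auto simp: u'_def v'_def)
  also have "\<dots> \<ge> (\<Sum>i\<in>B. (t i - t (i - 1)) * \<eta>)"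
    using uv tle by (intro sum_mono mult_left_mono) (auto simp: u'_def v'_def)
  finally have "(\<Sum>i\<in>B. t i - t (i - 1)) * \<eta> \<le> riemann_sum g N t u' - riemann_sum g N t v'"
    by (simp add: sum_distrib_right)
  moreover have "riemann_sum g N t u' - riemann_sum g N t v' < e * \<eta>"
    using \<delta>[OF tp(1) mesh] \<delta>[OF tp(2) mesh] by linarith
  ultimately have "(\<Sum>i\<in>B. t i - t (i - 1)) * \<eta> < e * \<eta>" by linarith
  then have len: "(\<Sum>i\<in>B. t i - t (i - 1)) < e"
    using \<open>0 < \<eta>\<close> by simp
  define T where "T = (\<Union>i\<in>B. J i) \<union> t ` {0..N}"
  have UJ: "(\<Union>i\<in>B. J i) \<in> lmeasurable"
    unfolding J_def using B by (intro fmeasurable.finite_UN) auto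
  have fin: "negligible (t ` {0..N})" by (simp add: negligible_finite)
  then have "t ` {0..N} \<in> lmeasurable" by (rule negligible_imp_measurable)
  with UJ have "T \<in> lmeasurable" unfolding T_def by (rule fmeasurable.Un)
  moreover have "measure lebesgue T \<le> e"
  proof -
    have "measure lebesgue T \<le> measure lebesgue (\<Union>i\<in>B. J i) + measure lebesgue (t ` {0..N})"
      unfolding T_def using UJ \<open>t ` {0..N} \<in> lmeasurable\<close> by (intro measure_Un_le) auto
    also have "measure lebesgue (t ` {0..N}) = 0"
      using fin by (rule negligible_imp_measure0)
    also have "measure lebesgue (\<Union>i\<in>B. J i) \<le> (\<Sum>i\<in>B. measure lebesgue (J i))"
      using B by (intro measure_UNION_le) (auto simp: J_def)
    also have "\<dots> = (\<Sum>i\<in>B. t i - t (i - 1))"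
      using tle by (simp add: J_def)
    finally show ?thesis using len by simp
  qed
  moreover have "oscillation_ge_set g {a..b} \<eta> \<subseteq> T"
  proof
    fix x assume x: "x \<in> oscillation_ge_set g {a..b} \<eta>"
    then have "x \<in> {t 0..t N}" by (simp add: oscillation_ge_set_def t0N)
    from partition_cover[OF this] show "x \<in> T"
    proof
      assume "\<exists>i\<in>{1..N}. t (i - 1) < x \<and> x < t i"
      then obtain i where i: "i \<in> {1..N}" "t (i - 1) < x" "x < t i" by blast
      \<comment> \<open>Within the distance to the nearer end point, the witness \<open>y\<close> of
        oscillation stays in \<open>J i\<close>.\<close>
      then have "0 < min (x - t (i - 1)) (t i - x)" by simp
      then obtain y where y: "\<bar>y - x\<bar> < min (x - t (i - 1)) (t i - x)" "\<eta> \<le> \<bar>g y - g x\<bar>"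
        using x unfolding oscillation_ge_set_def by blast
      have "x \<in> J i" "y \<in> J i" using i y by (auto simp: J_def)
      moreover have "\<eta> \<le> g y - g x \<or> \<eta> \<le> g x - g y" using y(2) by linarith
      ultimately have "i \<in> B" using i(1) by (auto simp: B_def)
      then show "x \<in> T" using \<open>x \<in> J i\<close> by (auto simp: T_def)
    qed (simp add: T_def)
  qed
  ultimately show "\<exists>T. oscillation_ge_set g {a..b} \<eta> \<subseteq> T \<and> T \<in> lmeasurable \<and> measure lebesgue T \<le> e"
    by blast
qed

lemma riemann_sum_coord:
  fixes f :: "real \<Rightarrow> romega"
  shows "riemann_sum f N t s n = riemann_sum (\<lambda>x. f x n) N t s"
proof -
  have "(\<Sum>i\<in>A. c i *\<^sub>R f (s i)) n = (\<Sum>i\<in>A. c i *\<^sub>R f (s i) n)" if "finite A"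
    for A :: "nat set" and c
    using that by induction (auto simp: scaleR_fun_def)
  then show ?thesis by (simp add: riemann_sum_def)
qed

text \<open>The metric induces the product topology, so convergence may be checked coordinate by
  coordinate; some threshold \<open>1 / real (Suc k)\<close> lies below any given
  \<open>e\<close>.\<close>

lemma topcontinuous_at_romegaI:
  fixes f :: "real \<Rightarrow> romega"
  assumes "x \<in> S"
    and "\<And>n k. x \<notin> oscillation_ge_set (\<lambda>x. f x n) S (1 / real (Suc k))"
  shows "topcontinuous_at (top_of_set S) romega.mtopology f x"
proof -
  have "((\<lambda>y. f y n) \<longlongrightarrow> f x n) (at x within S)" for n
    unfolding tendsto_iff
  proof (intro allI impI)
    fix e :: real assume "0 < e"
    then obtain k where k: "1 / real (Suc k) < e"
      using nat_approx_posE by blast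
    obtain r where "0 < r" "\<And>y. y \<in> S \<Longrightarrow> \<bar>y - x\<bar> < r \<Longrightarrow> \<bar>f y n - f x n\<bar> < 1 / real (Suc k)"
      using assms(1) assms(2)[of n k] unfolding oscillation_ge_set_def by (auto simp: not_le)
    with k show "\<forall>\<^sub>F y in at x within S. dist (f y n) (f x n) < e"
      unfolding eventually_at by (fastforce simp: dist_real_def)
  qed
  \<comment> \<open>This identifies the limit filter of the abstract topology with the type-class
    filter used above.\<close>
  moreover have "atin_within euclideanreal x S = at x within S"
    by (auto simp: filter_eq_iff eventually_atin_within eventually_at_topological)
  ultimately show ?thesis
    using assms(1)
    by (simp add: topcontinuous_at_atin romega_mtopology limitin_componentwise atin_subtopology_within)
qed

theorem theorem3p2:
  shows "romega.lebesgue_property"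
  unfolding romega.lebesgue_property_def
proof (intro allI impI)
  fix a b :: real and f :: "real \<Rightarrow> romega"
  assume "a < b \<and> romega.riemann_integrable_on f a b"
  then obtain l where ab: "a < b" and l: "\<And>\<epsilon>. 0 < \<epsilon> \<Longrightarrow> \<exists>\<delta>>0. \<forall>N t s.
      tagged_partition a b N t s \<and> mesh N t < \<delta> \<longrightarrow> romega_dist (riemann_sum f N t s) l < \<epsilon>"
    unfolding romega.riemann_integrable_on_def by blast
  \<comment> \<open>Restricting the thresholds to reciprocals of positive integers keeps the family
    of exceptional sets countable.\<close>
  define D where "D n k = oscillation_ge_set (\<lambda>x. f x n) {a..b} (1 / real (Suc k))" for n k
  have "negligible (D n k)" for n k
    unfolding D_def
  proof (rule negligible_oscillation_ge_set[OF ab])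
    fix \<epsilon> :: real assume "0 < \<epsilon>"
    \<comment> \<open>Coordinate \<open>n\<close> enters the metric truncated at 1 and with weight
      \<open>1 / real (Suc n)\<close>; a distance below this bound forces an error below
      \<open>\<epsilon>\<close> there.\<close>
    then have "0 < min \<epsilon> 1 / real (Suc n)" by simp
    from l[OF this] show "\<exists>\<delta>>0. \<forall>N t s. tagged_partition a b N t s \<and> mesh N t < \<delta> \<longrightarrow>
        \<bar>riemann_sum (\<lambda>x. f x n) N t s - l n\<bar> < \<epsilon>"
      unfolding riemann_sum_coord[symmetric] using romega_dist_coord_less by metis
  qed simp
  then have "negligible (\<Union>(n, k)\<in>UNIV. D n k)"
    by (intro negligible_countable_Union) auto
  then have "(\<Union>(n, k)\<in>UNIV. D n k) \<in> null_sets lebesgue"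
    by (simp add: negligible_iff_null_sets)
  then have "AE x in lebesgue. x \<in> {a..b} \<longrightarrow>
      topcontinuous_at (top_of_set {a..b}) romega.mtopology f x"
    by (rule AE_I') (auto intro: topcontinuous_at_romegaI simp: D_def)
  then show "AE x in lebesgue_on {a..b}.
      topcontinuous_at (top_of_set {a..b}) romega.mtopology f x"
    by (subst AE_restrict_space_iff) auto
qed

end
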